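(* Let $p$ be a prime, let $k\ge 3$ be an integer and let $d$ be an integer with $(d,p)=1$. Define \[ S_k(d)=\mathop{\sum_{a_1=1}^{p-1}\sum_{a_2=1}^{p-1}\cdots\sum_{a_k=1}^{p-1}}_{a_1a_2\cdots a_k\equiv d\pmod p} a_1a_2\cdots a_k. \] Then \[ S_k(d)=\frac{p^k(p-1)^{k-1}}{2^k}+O_k\bigl(p^{3k/2}(\log p)^k\bigr), \] where the implied constant depends only on $k$.
   Context: $f=O_k(g)$ means $|f|\le Cg$ for some constant $C>0$ depending only on $k$. *)

theory Defs
  imports Complex_Main "HOL-Library.FuncSet" "HOL-Number_Theory.Cong"
begin

definition prod_residue_sum :: "nat \<Rightarrow> nat \<Rightarrow> int \<Rightarrow> nat" where
  "prod_residue_sum p k d =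
     (\<Sum>a \<in> {a \<in> {1..k} \<rightarrow>\<^sub>E {1..p - 1}. [int (\<Prod>i=1..k. a i) = d] (mod int p)}.
        \<Prod>i=1..k. a i)"

end

theory Submission
  imports Defs "HOL-Analysis.Analysis" "HOL-Number_Theory.Residues"
begin

text \<open>
  Let \<open>T\<close> be the operator of
  multiplicative convolution with the function \<open>a \<mapsto> a\<close> on the units modulo \<open>p\<close>, so that
  \<open>S\<close> for \<open>k + 1\<close> factors is \<open>T\<close> applied to \<open>S\<close> for \<open>k\<close> factors. \<open>T\<close> multiplies constants
  by \<open>p (p - 1) / 2\<close>, which produces the main term, and preserves the functions of mean zero.
  On the latter, expand \<open>t mod p\<close> into additive characters \<open>e(h t / p)\<close>. By orthogonality, the
  kernel \<open>e(h d b\<^sup>-\<^sup>1 / p)\<close> with \<open>h \<noteq> 0\<close> has \<open>l\<^sup>2\<close> operator norm at most \<open>sqrt p\<close>, and the Fourier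
  coefficients have absolute sum at most \<open>6 p log p\<close>. Hence each application of \<open>T\<close> costs a
  factor \<open>6 p powr (3/2) log p\<close>. Starting from \<open>k = 0\<close>, where \<open>S\<close> is the indicator function
  of \<open>1\<close>, the error after \<open>k\<close> steps is at most the \<open>k\<close>-th power of this factor in \<open>l\<^sup>2\<close> norm,
  and so pointwise.
\<close>


section \<open>Norm, sine and harmonic sum inequalities\<close>

text \<open>Minkowski's inequality, by induction from two summands. It lets the frequencies of a
  Fourier expansion be estimated one at a time.\<close>

lemma L2_set_sum_le:
  assumes "finite I"
  shows "L2_set (\<lambda>x. norm (\<Sum>i\<in>I. f i x :: 'b::real_normed_vector)) A
       \<le> (\<Sum>i\<in>I. L2_set (\<lambda>x. norm (f i x)) A)"
  using assms
proof (induction I rule: finite_induct)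
  case empty
  show ?case by (simp add: L2_set_def)
next
  case (insert i I)
  have "L2_set (\<lambda>x. norm (\<Sum>j\<in>insert i I. f j x)) A
      \<le> L2_set (\<lambda>x. norm (f i x) + norm (\<Sum>j\<in>I. f j x)) A"
    using insert.hyps by (intro L2_set_mono) (auto intro: norm_triangle_ineq)
  also have "\<dots> \<le> L2_set (\<lambda>x. norm (f i x)) A + L2_set (\<lambda>x. norm (\<Sum>j\<in>I. f j x)) A"
    by (rule L2_set_triangle_ineq)
  finally show ?case using insert by simp
qed

text \<open>The Taylor remainder is at most \<open>x ^ 3 / 6\<close>, hence at most
  \<open>2 * x / 3\<close> on this range, which covers \<open>[0, pi / 2]\<close> because
  \<open>pi < 4\<close>.\<close>

lemma sin_ge_third:
  fixes x :: real
  assumes "0 \<le> x" "x \<le> 2"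
  shows "x / 3 \<le> sin x"
proof -
  have "\<bar>sin x - (\<Sum>m<3. sin_coeff m * x ^ m)\<bar> \<le> inverse (fact 3) * \<bar>x\<bar> ^ 3"
    by (rule Maclaurin_sin_bound)
  moreover have "(\<Sum>m<3. sin_coeff m * x ^ m) = x"
    by (simp add: eval_nat_numeral sin_coeff_def)
  moreover have "inverse (fact 3) * \<bar>x\<bar> ^ 3 \<le> 2 * x / 3"
  proof -
    have "x ^ 2 \<le> 2 ^ 2" using assms by (intro power_mono) auto
    hence "x * x ^ 2 \<le> x * 4" using assms by (intro mult_left_mono) auto
    thus ?thesis using assms by (simp add: eval_nat_numeral)
  qed
  ultimately show ?thesis by linarith
qed

lemma sum_inverse_le_ln:
  assumes "n \<ge> 2"
  shows "(\<Sum>h\<in>{1..<n}. 1 / real h) \<le> 3 * ln (real n)"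
proof -
  obtain m where m: "n = Suc (Suc m)" using assms by (metis add_2_eq_Suc le_Suc_ex)
  have "harm (Suc m) - ln (real (Suc m)) \<le> harm (Suc 0) - ln (real (Suc 0))"
    using decseqD[OF decseq_harm_diff_ln, of 0 m] by simp
  hence "harm (Suc m) \<le> 1 + ln (real (Suc m))" by (simp add: harm_expand)
  moreover have "(\<Sum>h\<in>{1..<n}. 1 / real h) = harm (Suc m)"
    by (simp add: harm_def m atLeastLessThanSuc_atLeastAtMost inverse_eq_divide)
  moreover have "ln (real (Suc m)) \<le> ln (real n)" using m by simp
  \<comment> \<open>This absorbs the constant in \<open>1 + ln n\<close> into
    \<open>2 * ln n\<close>, whence the factor 3.\<close>
  moreover have "1 / 2 \<le> ln (real n)"
  proof -
    have "ln 2 \<le> ln (real n)" using assms by simp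
    thus ?thesis using ln_diff_le[of 1 2] by simp
  qed
  ultimately show ?thesis by linarith
qed

section \<open>Additive characters and the Fourier expansion of \<open>t mod p\<close>\<close>

definition echar :: "nat \<Rightarrow> int \<Rightarrow> complex" where
  "echar p t = cis (2 * pi * of_int t / of_nat p)"

lemma echar_add: "echar p (s + t) = echar p s * echar p t"
  by (simp add: echar_def cis_mult ring_distribs add_divide_distrib)

lemma cnj_echar: "cnj (echar p t) = echar p (- t)"
  by (simp add: echar_def cis_cnj)

lemma echar_0 [simp]: "echar p 0 = 1"
  by (simp add: echar_def)

lemma echar_power: "echar p (int n * t) = echar p t ^ n"
  by (simp add: echar_def Complex.DeMoivre mult_ac)

lemma echar_eq_1_iff:
  assumes "p > 0"
  shows "echar p t = 1 \<longleftrightarrow> int p dvd t"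
proof
  assume "echar p t = 1"
  hence "cos (2 * pi * of_int t / of_nat p) = 1"
    by (simp add: echar_def complex_eq_iff)
  then obtain n :: int where "2 * pi * of_int t / of_nat p = of_int n * 2 * pi"
    by (auto simp: cos_one_2pi_int)
  hence "real_of_int t = of_int (n * int p)"
    using assms by (simp add: field_simps)
  hence "t = n * int p" by (simp only: of_int_eq_iff)
  thus "int p dvd t" by simp
next
  assume "int p dvd t"
  then obtain n where n: "t = int p * n" by blast
  have "2 * pi * of_int t / of_nat p = 2 * pi * of_int n"
    using assms by (simp add: n)
  thus "echar p t = 1" by (simp add: echar_def)
qed

text \<open>Orthogonality of characters: a geometric sum whose ratio is a \<open>p\<close>-th root
  of unity. It yields both Fourier inversion and the norm of the character kernels.\<close>

lemma sum_echar:
  assumes "p > 0"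
  shows "(\<Sum>x<p. echar p (int x * t)) = (if int p dvd t then of_nat p else 0)"
proof (cases "int p dvd t")
  case True
  hence "echar p (int x * t) = 1" for x using assms by (simp add: echar_eq_1_iff)
  thus ?thesis using True by simp
next
  case False
  hence "echar p t \<noteq> 1" using assms by (simp add: echar_eq_1_iff)
  moreover have "echar p t ^ p = 1"
    using assms by (simp add: echar_eq_1_iff flip: echar_power)
  ultimately have "(\<Sum>x<p. echar p t ^ x) = 0" by (simp add: geometric_sum)
  thus ?thesis using False by (simp add: echar_power)
qed

text \<open>The Fourier coefficients of the sawtooth \<open>t mod p\<close>, with the factor
  \<open>1 / p\<close> placed here so that the inversion formula carries none.\<close>

definition saw_coeff :: "nat \<Rightarrow> nat \<Rightarrow> complex" where
  "saw_coeff p h = (\<Sum>x<p. of_nat x * echar p (- (int h * int x))) / of_nat p"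

text \<open>After exchanging the sums, orthogonality in \<open>h\<close> leaves only the term where
  \<open>x\<close> is the residue of \<open>t\<close>.\<close>

lemma mod_eq_fourier:
  assumes "p > 0"
  shows "of_int (t mod int p) = (\<Sum>h<p. saw_coeff p h * echar p (int h * t))"
proof -
  have "(\<Sum>h<p. saw_coeff p h * echar p (int h * t))
      = (\<Sum>h<p. \<Sum>x<p. of_nat x / of_nat p * echar p (int h * (t - int x)))"
    by (simp add: saw_coeff_def sum_distrib_right sum_divide_distrib right_diff_distrib
        flip: echar_add mult.assoc) (simp add: echar_add[of p _ "- _", simplified] mult_ac)
  also have "\<dots> = (\<Sum>x<p. of_nat x / of_nat p * (\<Sum>h<p. echar p (int h * (t - int x))))"
    by (subst sum.swap) (simp add: sum_distrib_left)
  also have "\<dots> = (\<Sum>x<p. if x = nat (t mod int p) then of_nat x else 0)"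
  proof (intro sum.cong refl)
    fix x assume "x \<in> {..<p}"
    hence "int p dvd t - int x \<longleftrightarrow> x = nat (t mod int p)"
      using assms by (auto simp: mod_eq_dvd_iff[symmetric])
    thus "of_nat x / of_nat p * (\<Sum>h<p. echar p (int h * (t - int x)))
        = (if x = nat (t mod int p) then of_nat x else (0::complex))"
      using assms by (simp add: sum_echar)
  qed
  also have "\<dots> = of_nat (nat (t mod int p))"
    using assms by (subst sum.delta) (auto simp: nat_less_iff)
  also have "\<dots> = of_int (t mod int p)"
    using assms by simp
  finally show ?thesis by simp
qed

lemma norm_echar_diff_1: "norm (echar p t - 1) = 2 * \<bar>sin (pi * of_int t / of_nat p)\<bar>"
  using dist_exp_i_1[of "2 * pi * of_int t / of_nat p"]
  by (simp add: echar_def cis_conv_exp)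

lemma saw_coeff_eq:
  assumes "\<not> p dvd h" "p > 0"
  shows "saw_coeff p h = 1 / (echar p (- int h) - 1)"
proof -
  define w where "w = echar p (- int h)"
  have w: "w \<noteq> 1" "w ^ p = 1"
    using assms by (simp_all add: w_def echar_eq_1_iff flip: echar_power)
  \<comment> \<open>Summation by parts. At \<open>n = p\<close> the geometric sum on the right
    vanishes and \<open>w ^ p = 1\<close>.\<close>
  have "(w - 1) * (\<Sum>x<n. of_nat x * w ^ x) = of_nat n * w ^ n - w * (\<Sum>x<n. w ^ x)" for n
    by (induction n) (simp_all add: algebra_simps)
  from this[of p] have "(w - 1) * (\<Sum>x<p. of_nat x * w ^ x) = of_nat p"
    using w by (simp add: geometric_sum)
  moreover have "(\<Sum>x<p. of_nat x * w ^ x) = saw_coeff p h * of_nat p"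
    using assms by (simp add: saw_coeff_def w_def mult_ac flip: echar_power)
  ultimately have "((w - 1) * saw_coeff p h) * of_nat p = 1 * of_nat p"
    by (simp add: mult_ac)
  hence "(w - 1) * saw_coeff p h = 1" using assms by (subst (asm) mult_right_cancel) auto
  thus ?thesis using w by (simp add: field_simps flip: w_def)
qed

text \<open>The norm is exactly \<open>1 / (2 * sin y)\<close>. The sine is small near both
  \<open>0\<close> and \<open>pi\<close>, and each end accounts for one of the two terms.\<close>

lemma norm_saw_coeff_le:
  assumes "h \<in> {1..<p}"
  shows "norm (saw_coeff p h) \<le> real p * (1 / real h + 1 / real (p - h))"
proof -
  define y where "y = pi * real h / real p"
  have p: "p > 0" and h: "0 < h" "h < p" using assms by auto
  have y: "0 < y" "y < pi" using h by (simp_all add: y_def field_simps)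
  \<comment> \<open>The factor \<open>1 / 3\<close> from the sine bound is harmless since
    \<open>2 * pi / 3 > 1\<close>.\<close>
  have bound: "1 / (2 * s) \<le> real p / real m" if "pi * real m / real p / 3 \<le> s" "m > 0" for s m
  proof -
    have "real m / real p \<le> 2 * (pi * real m / real p / 3)"
      using that p pi_gt3 by (simp add: field_simps)
    hence "real m / real p \<le> 2 * s" using that by linarith
    moreover have "0 < real m / real p" using that p by simp
    ultimately have "1 / (2 * s) \<le> 1 / (real m / real p)" by (intro frac_le) auto
    thus ?thesis by simp
  qed
  have "norm (saw_coeff p h) = 1 / (2 * sin y)"
    using h y sin_gt_zero[of y]
    by (simp add: saw_coeff_eq nat_dvd_not_less norm_divide norm_echar_diff_1 flip: y_def)
  also have "\<dots> \<le> real p / real h + real p / real (p - h)"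
  proof (cases "y \<le> pi / 2")
    case True
    hence "y / 3 \<le> sin y" using y pi_less_4 by (intro sin_ge_third) auto
    hence "1 / (2 * sin y) \<le> real p / real h" using h by (intro bound) (auto simp: y_def)
    thus ?thesis by (simp add: add_increasing2)
  next
    case False
    hence "(pi - y) / 3 \<le> sin (pi - y)" using y pi_less_4 by (intro sin_ge_third) auto
    moreover have "pi - y = pi * real (p - h) / real p"
      using h by (simp add: y_def field_simps of_nat_diff)
    ultimately have "pi * real (p - h) / real p / 3 \<le> sin y" by (metis sin_pi_minus)
    hence "1 / (2 * sin y) \<le> real p / real (p - h)" using h by (intro bound) auto
    thus ?thesis by (simp add: add_increasing)
  qed
  finally show ?thesis by (simp add: ring_distribs)
qed

lemma sum_norm_saw_coeff_le:
  assumes "p \<ge> 2"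
  shows "(\<Sum>h\<in>{1..<p}. norm (saw_coeff p h)) \<le> 6 * real p * ln (real p)"
proof -
  have "(\<Sum>h\<in>{1..<p}. norm (saw_coeff p h))
      \<le> (\<Sum>h\<in>{1..<p}. real p * (1 / real h + 1 / real (p - h)))"
    by (intro sum_mono norm_saw_coeff_le)
  also have "\<dots> = real p * ((\<Sum>h\<in>{1..<p}. 1 / real h) + (\<Sum>h\<in>{1..<p}. 1 / real (p - h)))"
    by (simp add: sum_distrib_left sum.distrib ring_distribs)
  also have "(\<Sum>h\<in>{1..<p}. 1 / real (p - h)) = (\<Sum>h\<in>{1..<p}. 1 / real h)"
    by (rule sum.reindex_bij_witness[where i="\<lambda>h. p - h" and j="\<lambda>h. p - h"]) auto
  also have "real p * ((\<Sum>h\<in>{1..<p}. 1 / real h) + (\<Sum>h\<in>{1..<p}. 1 / real h))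
      \<le> real p * (3 * ln (real p) + 3 * ln (real p))"
    using sum_inverse_le_ln[OF assms] by (intro mult_left_mono add_mono) auto
  finally show ?thesis by simp
qed


section \<open>Inverses modulo \<open>p\<close> and multiplicative convolution\<close>

text \<open>Fermat's little theorem. For \<open>p = 2\<close> the exponent is \<open>0\<close>,
  which is still right because \<open>b\<close> is then odd.\<close>

lemma power_inverse_cong:
  assumes "prime p" "\<not> p dvd b"
  shows "[int b * int b ^ (p - 2) = 1] (mod int p)"
proof -
  have "p - 1 = Suc (p - 2)" using prime_ge_2_nat[OF assms(1)] by simp
  hence "[b * b ^ (p - 2) = 1] (mod p)"
    using fermat_theorem[OF assms] by simp
  hence "[int (b * b ^ (p - 2)) = int 1] (mod int p)"
    by (simp only: cong_int_iff)
  thus ?thesis by simp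
qed

text \<open>Inversion is injective: if the inverses agree, then
  \<open>b = b * c * c ^ (p - 2) = b * c * b ^ (p - 2) = c\<close> modulo \<open>p\<close>.\<close>

lemma power_inverse_cong_iff:
  assumes "prime p" "b \<in> {1..<p}" "c \<in> {1..<p}"
  shows "[int b ^ (p - 2) = int c ^ (p - 2)] (mod int p) \<longleftrightarrow> b = c"
proof
  have ndvd: "\<not> p dvd b" "\<not> p dvd c" using assms by (auto simp: nat_dvd_not_less)
  assume *: "[int b ^ (p - 2) = int c ^ (p - 2)] (mod int p)"
  have "[int b = int b * (int c * int c ^ (p - 2))] (mod int p)"
    using cong_scalar_left[OF cong_sym[OF power_inverse_cong[OF assms(1) ndvd(2)]], of "int b"]
    by simp
  also have "[int b * (int c * int c ^ (p - 2)) = int b * (int c * int b ^ (p - 2))] (mod int p)"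
    using * by (intro cong_scalar_left) (rule cong_sym)
  also have "[int b * (int c * int b ^ (p - 2)) = int c] (mod int p)"
    using cong_scalar_left[OF power_inverse_cong[OF assms(1) ndvd(1)], of "int c"]
    by (simp add: mult_ac)
  finally have "[b = c] (mod p)" by (simp add: cong_int_iff)
  thus "b = c" using assms by (auto intro: cong_less_modulus_unique_nat)
qed simp

lemma not_dvd_residue_power:
  assumes "prime p" "b \<in> {1..<p}"
  shows "\<not> int p dvd int b ^ n"
proof
  assume "int p dvd int b ^ n"
  hence "p dvd b" using assms(1) by (metis of_nat_power int_dvd_int_iff prime_dvd_power)
  thus False using assms(2) by (auto simp: nat_dvd_not_less)
qed

text \<open>Reducing \<open>u\<close> modulo \<open>p\<close> gives an injective self-map of the
  finite set \<open>{1..<p}\<close>, hence a permutation. This evaluates both the row and the column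
  sums of the convolution kernel.\<close>

lemma sum_mod_permutation:
  assumes "p > 0"
    and inj: "\<And>b c. b \<in> {1..<p} \<Longrightarrow> c \<in> {1..<p} \<Longrightarrow> [u b = u c] (mod int p) \<Longrightarrow> b = c"
    and ndvd: "\<And>b. b \<in> {1..<p} \<Longrightarrow> \<not> int p dvd u b"
  shows "(\<Sum>b\<in>{1..<p}. real_of_int (u b mod int p)) = real p * (real p - 1) / 2"
proof -
  define v where "v b = nat (u b mod int p)" for b
  have v: "int (v b) = u b mod int p" for b using assms(1) by (simp add: v_def)
  have "inj_on v {1..<p}"
  proof (rule inj_onI)
    fix b c assume bc: "b \<in> {1..<p}" "c \<in> {1..<p}" "v b = v c"
    hence "int (v b) = int (v c)" by simp
    hence "[u b = u c] (mod int p)" by (simp add: v Cong.cong_def)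
    thus "b = c" by (rule inj[OF bc(1,2)])
  qed
  moreover have "v ` {1..<p} \<subseteq> {1..<p}"
  proof
    fix x assume "x \<in> v ` {1..<p}"
    then obtain b where b: "b \<in> {1..<p}" "x = v b" by blast
    have "int x \<noteq> 0" using ndvd[OF b(1)] by (auto simp: b v)
    moreover have "int x < int p" using assms(1) by (simp add: b v)
    ultimately show "x \<in> {1..<p}" by simp
  qed
  ultimately have img: "v ` {1..<p} = {1..<p}" by (intro endo_inj_surj) auto
  have "(\<Sum>b\<in>{1..<p}. real_of_int (u b mod int p)) = (\<Sum>b\<in>{1..<p}. real (v b))"
    by (simp flip: v)
  also have "\<dots> = (\<Sum>b\<in>v ` {1..<p}. real b)"
    using \<open>inj_on v _\<close> by (simp add: sum.reindex)
  also have "\<dots> = (\<Sum>b\<in>{1..<p}. real b)" by (simp only: img)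
  also have "\<dots> = real p * (real p - 1) / 2"
    using assms(1)
  proof (induction p rule: nat_induct_non_zero)
    case (Suc n)
    thus ?case by (simp add: field_simps)
  qed simp
  finally show ?thesis .
qed

text \<open>Multiplicative convolution of \<open>g\<close> with the function \<open>a \<mapsto> a\<close> on the units modulo
  \<open>p\<close>: by Fermat's little theorem \<open>b ^ (p - 2)\<close> is the inverse of \<open>b\<close>.\<close>

definition residue_conv :: "nat \<Rightarrow> (nat \<Rightarrow> real) \<Rightarrow> int \<Rightarrow> real" where
  "residue_conv p g d = (\<Sum>b\<in>{1..<p}. real_of_int ((d * int b ^ (p - 2)) mod int p) * g b)"

text \<open>Every row of the kernel sums to \<open>p * (p - 1) / 2\<close>; this factor drives the
  growth of the main term.\<close>

lemma residue_conv_diff_const: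
  assumes "prime p" "coprime d (int p)"
  shows "residue_conv p (\<lambda>b. g b - c) d = residue_conv p g d - c * (real p * (real p - 1) / 2)"
proof -
  have pp: "prime (int p)" using assms by simp
  have d: "\<not> int p dvd d"
    using assms pp by (metis coprime_absorb_right not_prime_unit)
  have "(\<Sum>b\<in>{1..<p}. real_of_int ((d * int b ^ (p - 2)) mod int p)) = real p * (real p - 1) / 2"
  proof (rule sum_mod_permutation)
    show "p > 0" using assms(1) by (rule prime_gt_0_nat)
    fix b assume b: "b \<in> {1..<p}"
    show "\<not> int p dvd d * int b ^ (p - 2)"
      using d not_dvd_residue_power[OF assms(1) b] pp by (simp add: prime_dvd_mult_iff)
    fix c assume "c \<in> {1..<p}" "[d * int b ^ (p - 2) = d * int c ^ (p - 2)] (mod int p)"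
    thus "b = c"
      using b assms by (simp add: cong_mult_lcancel power_inverse_cong_iff)
  qed
  hence "(\<Sum>b\<in>{1..<p}. c * real_of_int ((d * int b ^ (p - 2)) mod int p))
      = c * (real p * (real p - 1) / 2)"
    by (simp only: flip: sum_distrib_left)
  thus ?thesis
    unfolding residue_conv_def right_diff_distrib sum_subtractf by (simp only: mult.commute)
qed

text \<open>The column sums of the kernel are all equal too, so convolution preserves mean
  zero.\<close>

lemma sum_residue_conv:
  assumes "prime p"
  shows "(\<Sum>d\<in>{1..<p}. residue_conv p g (int d)) = real p * (real p - 1) / 2 * (\<Sum>b\<in>{1..<p}. g b)"
proof -
  have pp: "prime (int p)" using assms by simp
  have "(\<Sum>d\<in>{1..<p}. real_of_int ((int d * int b ^ (p - 2)) mod int p)) = real p * (real p - 1) / 2"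
    if b: "b \<in> {1..<p}" for b
  proof (rule sum_mod_permutation)
    show "p > 0" using assms by (rule prime_gt_0_nat)
    have nb: "\<not> int p dvd int b ^ (p - 2)"
      using assms b by (rule not_dvd_residue_power)
    hence co: "coprime (int b ^ (p - 2)) (int p)"
      using pp by (metis coprime_commute prime_imp_coprime)
    fix d assume d: "d \<in> {1..<p}"
    show "\<not> int p dvd int d * int b ^ (p - 2)"
      using d nb pp by (auto simp: prime_dvd_mult_iff nat_dvd_not_less)
    fix c assume c: "c \<in> {1..<p}" "[int d * int b ^ (p - 2) = int c * int b ^ (p - 2)] (mod int p)"
    hence "[d = c] (mod p)" using co by (simp add: cong_mult_rcancel cong_int_iff)
    thus "d = c" using c d by (auto intro: cong_less_modulus_unique_nat)
  qed
  thus ?thesis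
    unfolding residue_conv_def sum_distrib_left
    by (subst sum.swap) (auto simp only: sum_distrib_right[symmetric] intro!: sum.cong)
qed

section \<open>The \<open>l2\<close> bound for convolution on functions of mean zero\<close>

text \<open>Plancherel: expand the squared norm and sum over \<open>d\<close> first. As
  \<open>h\<close> is invertible and inversion is injective, orthogonality leaves only the diagonal
  \<open>b = c\<close>. Letting \<open>d\<close> run over all residues, \<open>0\<close> included,
  makes this an equality.\<close>

lemma L2_set_echar_transform:
  assumes "prime p" "h \<in> {1..<p}"
  shows "L2_set (\<lambda>d. norm (\<Sum>b\<in>{1..<p}.
           echar p (int h * (int d * int b ^ (p - 2))) * complex_of_real (g b))) {..<p}
       = sqrt (real p) * L2_set g {1..<p}"
proof -
  let ?G = "{1..<p}" and ?u = "\<lambda>b. int b ^ (p - 2)"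
  have p0: "p > 0" using assms(1) by (rule prime_gt_0_nat)
  have pp: "prime (int p)" using assms by simp
  define U where "U d = (\<Sum>b\<in>?G. echar p (int h * (int d * ?u b)) * complex_of_real (g b))" for d
  have "complex_of_real (\<Sum>d<p. (norm (U d))\<^sup>2) = (\<Sum>d<p. U d * cnj (U d))"
    by (simp only: of_real_sum complex_norm_square)
  also have "\<dots> = (\<Sum>d<p. \<Sum>b\<in>?G. \<Sum>c\<in>?G.
      complex_of_real (g b * g c) * echar p (int d * (int h * (?u b - ?u c))))"
  proof (intro sum.cong refl)
    fix d
    have "echar p (int d * (int h * (?u b - ?u c)))
        = echar p (int h * (int d * ?u b)) * echar p (- (int h * (int d * ?u c)))" for b c
      by (simp add: algebra_simps flip: echar_add)
    thus "U d * cnj (U d) = (\<Sum>b\<in>?G. \<Sum>c\<in>?G.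
        complex_of_real (g b * g c) * echar p (int d * (int h * (?u b - ?u c))))"
      unfolding U_def cnj_sum sum_product
      by (intro sum.cong refl) (simp add: cnj_echar mult_ac)
  qed
  also have "\<dots> = (\<Sum>b\<in>?G. \<Sum>c\<in>?G. complex_of_real (g b * g c) *
      (\<Sum>d<p. echar p (int d * (int h * (?u b - ?u c)))))"
    unfolding sum_distrib_left
    by (rule trans[OF sum.swap]) (intro sum.cong refl sum.swap)
  also have "\<dots> = (\<Sum>b\<in>?G. \<Sum>c\<in>?G. if b = c then complex_of_real (real p * (g b)\<^sup>2) else 0)"
  proof (intro sum.cong refl)
    fix b c assume bc: "b \<in> ?G" "c \<in> ?G"
    have "int p dvd int h * (?u b - ?u c) \<longleftrightarrow> b = c"
      using power_inverse_cong_iff[OF assms(1) bc] assms pp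
      by (auto simp: prime_dvd_mult_iff nat_dvd_not_less cong_iff_dvd_diff)
    thus "complex_of_real (g b * g c) * (\<Sum>d<p. echar p (int d * (int h * (?u b - ?u c))))
        = (if b = c then complex_of_real (real p * (g b)\<^sup>2) else 0)"
      using p0 by (simp add: sum_echar power2_eq_square)
  qed
  also have "\<dots> = complex_of_real (real p * (\<Sum>b\<in>?G. (g b)\<^sup>2))"
    by (simp add: sum_distrib_left)
  finally have "(\<Sum>d<p. (norm (U d))\<^sup>2) = real p * (\<Sum>b\<in>?G. (g b)\<^sup>2)"
    by (simp only: of_real_eq_iff)
  thus ?thesis unfolding L2_set_def U_def[symmetric] by (simp only: real_sqrt_mult)
qed

lemma L2_set_residue_conv_le:
  assumes "prime p" and sum0: "(\<Sum>b\<in>{1..<p}. g b) = 0"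
  shows "L2_set (\<lambda>d. residue_conv p g (int d)) {1..<p}
       \<le> 6 * real p * sqrt (real p) * ln (real p) * L2_set g {1..<p}"
proof -
  let ?G = "{1..<p}" and ?u = "\<lambda>b. int b ^ (p - 2)"
  have p2: "p \<ge> 2" using assms(1) by (rule prime_ge_2_nat)
  define U where "U h d = (\<Sum>b\<in>?G. echar p (int h * (int d * ?u b)) * complex_of_real (g b))" for h d
  \<comment> \<open>Mean zero removes the frequency \<open>h = 0\<close>, the one not covered by the
    transform identity or the coefficient bound.\<close>
  have U0: "U 0 d = 0" for d
    using sum0 by (simp add: U_def flip: of_real_sum)
  have exp: "complex_of_real (residue_conv p g (int d)) = (\<Sum>h\<in>?G. saw_coeff p h * U h d)" for d
  proof -
    have "complex_of_real (residue_conv p g (int d))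
        = (\<Sum>b\<in>?G. of_int ((int d * ?u b) mod int p) * complex_of_real (g b))"
      by (simp add: residue_conv_def)
    also have "\<dots> = (\<Sum>b\<in>?G. \<Sum>h<p. saw_coeff p h *
        (echar p (int h * (int d * ?u b)) * complex_of_real (g b)))"
      using p2 by (simp only: mod_eq_fourier sum_distrib_right mult.assoc)
    also have "\<dots> = (\<Sum>h<p. saw_coeff p h * U h d)"
      by (subst sum.swap) (simp add: U_def sum_distrib_left)
    also have "{..<p} = insert 0 ?G" using p2 by auto
    finally show ?thesis by (simp add: U0)
  qed
  have "L2_set (\<lambda>d. residue_conv p g (int d)) ?G
      = L2_set (\<lambda>d. norm (complex_of_real (residue_conv p g (int d)))) ?G"
    by (simp add: L2_set_def)
  \<comment> \<open>Adding \<open>d = 0\<close> only enlarges the norm and completes the residue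
    system.\<close>
  also have "\<dots> \<le> L2_set (\<lambda>d. norm (complex_of_real (residue_conv p g (int d)))) {..<p}"
    unfolding L2_set_def by (intro real_sqrt_le_mono sum_mono2) auto
  also have "\<dots> = L2_set (\<lambda>d. norm (\<Sum>h\<in>?G. saw_coeff p h * U h d)) {..<p}"
    by (simp only: exp)
  also have "\<dots> \<le> (\<Sum>h\<in>?G. L2_set (\<lambda>d. norm (saw_coeff p h * U h d)) {..<p})"
    by (rule L2_set_sum_le) simp
  also have "\<dots> = (\<Sum>h\<in>?G. norm (saw_coeff p h) * (sqrt (real p) * L2_set g ?G))"
  proof (intro sum.cong refl)
    fix h assume "h \<in> ?G"
    show "L2_set (\<lambda>d. norm (saw_coeff p h * U h d)) {..<p}
        = norm (saw_coeff p h) * (sqrt (real p) * L2_set g ?G)"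
      unfolding L2_set_echar_transform[OF assms(1) \<open>h \<in> ?G\<close>, of g, symmetric, folded U_def]
      by (simp add: norm_mult L2_set_right_distrib)
  qed
  also have "\<dots> = (\<Sum>h\<in>?G. norm (saw_coeff p h)) * (sqrt (real p) * L2_set g ?G)"
    by (simp only: sum_distrib_right)
  also have "\<dots> \<le> 6 * real p * ln (real p) * (sqrt (real p) * L2_set g ?G)"
    using sum_norm_saw_coeff_le[OF p2] by (intro mult_right_mono) auto
  finally show ?thesis by (simp add: mult_ac)
qed

section \<open>The recursion in the number of factors\<close>

lemma prod_residue_sum_cong:
  assumes "[d = e] (mod int p)"
  shows "prod_residue_sum p k d = prod_residue_sum p k e"
  using assms unfolding prod_residue_sum_def Cong.cong_def by simp

text \<open>With the congruence moved into the summand, the index set is a full product, from which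
  one coordinate can be split off.\<close>

lemma prod_residue_sum_alt:
  assumes "p > 0"
  shows "real (prod_residue_sum p k d) = (\<Sum>a\<in>{1..k} \<rightarrow>\<^sub>E {1..<p}.
    if [int (\<Prod>i=1..k. a i) = d] (mod int p) then real (\<Prod>i=1..k. a i) else 0)"
proof -
  have "{1..p - 1} = {1..<p}" using assms by auto
  thus ?thesis
    unfolding prod_residue_sum_def of_nat_sum
    by (subst sum.inter_filter[symmetric]) (auto intro: finite_PiE)
qed

text \<open>Solves for one factor \<open>x\<close> when the product \<open>n\<close> of the others
  is known modulo \<open>p\<close>, by multiplying with the inverse of its residue
  \<open>c\<close>.\<close>

lemma cong_mult_eq_iff:
  assumes "prime p" "coprime d (int p)" "c \<in> {1..<p}" "[n = c] (mod p)" "x \<in> {1..<p}"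
  shows "[int (x * n) = d] (mod int p) \<longleftrightarrow> x = nat ((d * int c ^ (p - 2)) mod int p)"
proof -
  have p0: "p > 0" using assms(1) by (rule prime_gt_0_nat)
  have inv: "[int c * int c ^ (p - 2) = 1] (mod int p)"
    using assms by (intro power_inverse_cong) (auto simp: nat_dvd_not_less)
  have n: "[int n = int c] (mod int p)" using assms(4) by (simp only: cong_int_iff)
  have "[int (x * n) = d] (mod int p) \<longleftrightarrow> [int x * int c = d] (mod int p)"
    using cong_scalar_left[OF n, of "int x"] by (simp add: Cong.cong_def)
  also have "\<dots> \<longleftrightarrow> [int x = d * int c ^ (p - 2)] (mod int p)"
  proof
    assume "[int x * int c = d] (mod int p)"
    from cong_scalar_right[OF this, of "int c ^ (p - 2)"] cong_scalar_left[OF inv, of "int x"]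
    show "[int x = d * int c ^ (p - 2)] (mod int p)"
      by (simp add: Cong.cong_def mult_ac)
  next
    assume "[int x = d * int c ^ (p - 2)] (mod int p)"
    from cong_scalar_right[OF this, of "int c"] cong_scalar_left[OF inv, of d]
    show "[int x * int c = d] (mod int p)"
      by (simp add: Cong.cong_def mult_ac)
  qed
  also have "\<dots> \<longleftrightarrow> x = nat ((d * int c ^ (p - 2)) mod int p)"
    using assms(5) p0 by (auto simp: Cong.cong_def nat_eq_iff)
  finally show ?thesis .
qed

text \<open>Split off the last factor. It is determined by \<open>d\<close> and the product of the
  other factors, which are then grouped by the residue \<open>b\<close> of that product.\<close>

lemma prod_residue_sum_Suc:
  assumes "prime p" "coprime d (int p)"
  shows "real (prod_residue_sum p (Suc k) d)
       = residue_conv p (\<lambda>b. real (prod_residue_sum p k (int b))) d"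
proof -
  let ?G = "{1..<p}" and ?r = "\<lambda>c. (d * int c ^ (p - 2)) mod int p"
  define A where "A = {1..k} \<rightarrow>\<^sub>E ?G"
  define P where "P a = (\<Prod>i=1..k. a i)" for a :: "nat \<Rightarrow> nat"
  have p0: "p > 0" using assms(1) by (rule prime_gt_0_nat)
  have pp: "prime (int p)" using assms by simp
  have nP: "\<not> p dvd P a" if "a \<in> A" for a
    using that assms(1)
    by (auto simp: P_def A_def prime_dvd_prod_iff nat_dvd_not_less dest!: PiE_mem)
  have Psuc: "(\<Prod>i=1..Suc k. (a(Suc k := x)) i) = x * P a" for a x
    by (simp add: P_def)
  \<comment> \<open>Each side has a single nonzero term: on the left the solution \<open>x\<close>,
    on the right the residue \<open>b\<close> of \<open>n\<close>.\<close>
  have key: "(\<Sum>x\<in>?G. if [int (x * n) = d] (mod int p) then real x else 0)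
      = (\<Sum>b\<in>?G. if [int n = int b] (mod int p) then real_of_int (?r b) else 0)"
    if n: "\<not> p dvd n" for n
  proof -
    define c where "c = n mod p"
    have c: "c \<in> ?G" "[n = c] (mod p)"
      using n p0 by (auto simp: c_def Cong.cong_def dvd_eq_mod_eq_0 Suc_le_eq)
    have "\<not> int p dvd d * int c ^ (p - 2)"
      using not_dvd_residue_power[OF assms(1) c(1)] pp assms(2)
      by (metis coprime_absorb_right not_prime_unit prime_dvd_mult_iff)
    hence r: "nat (?r c) \<in> ?G"
      using p0 by (auto simp: nat_less_iff Suc_le_eq dvd_eq_mod_eq_0 order_le_neq_trans)
    have "(\<Sum>x\<in>?G. if [int (x * n) = d] (mod int p) then real x else 0)
        = (\<Sum>x\<in>?G. if x = nat (?r c) then real x else 0)"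
      using c assms by (intro sum.cong) (auto simp only: cong_mult_eq_iff)
    also have "\<dots> = real_of_int (?r c)"
      using r p0 by simp
    also have "\<dots> = (\<Sum>b\<in>?G. if b = c then real_of_int (?r b) else 0)"
      using c by simp
    also have "\<dots> = (\<Sum>b\<in>?G. if [int n = int b] (mod int p) then real_of_int (?r b) else 0)"
    proof (intro sum.cong refl)
      fix b assume "b \<in> ?G"
      hence "[int n = int b] (mod int p) \<longleftrightarrow> b = c"
        unfolding cong_int_iff unfolding Cong.cong_def by (auto simp: c_def)
      thus "(if b = c then real_of_int (?r b) else 0)
          = (if [int n = int b] (mod int p) then real_of_int (?r b) else 0)" by simp
    qed
    finally show ?thesis .
  qed
  have ins: "insert (Suc k) {1..k} = {1..Suc k}" by auto
  have "real (prod_residue_sum p (Suc k) d) = (\<Sum>a\<in>insert (Suc k) {1..k} \<rightarrow>\<^sub>E ?G.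
      if [int (\<Prod>i=1..Suc k. a i) = d] (mod int p) then real (\<Prod>i=1..Suc k. a i) else 0)"
    unfolding ins by (rule prod_residue_sum_alt[OF p0])
  \<comment> \<open>A tuple of length \<open>Suc k\<close> corresponds bijectively to its last entry
    and its restriction to \<open>{1..k}\<close>.\<close>
  also have "\<dots> = (\<Sum>(x, a)\<in>?G \<times> A.
      if [int (x * P a) = d] (mod int p) then real (x * P a) else 0)"
    unfolding PiE_insert_eq A_def
    by (subst sum.reindex[OF inj_combinator])
       (auto simp only: o_def case_prod_unfold Psuc atLeastAtMost_iff intro!: sum.cong)
  also have "\<dots> = (\<Sum>a\<in>A. \<Sum>x\<in>?G. if [int (x * P a) = d] (mod int p) then real (x * P a) else 0)"
    by (subst sum.swap) (simp add: sum.cartesian_product)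
  also have "\<dots> = (\<Sum>a\<in>A. real (P a) *
      (\<Sum>x\<in>?G. if [int (x * P a) = d] (mod int p) then real x else 0))"
    unfolding sum_distrib_left by (intro sum.cong refl) auto
  also have "\<dots> = (\<Sum>a\<in>A. real (P a) *
      (\<Sum>b\<in>?G. if [int (P a) = int b] (mod int p) then real_of_int (?r b) else 0))"
    by (intro sum.cong refl arg_cong2[where f = "(*)"] key nP)
  also have "\<dots> = (\<Sum>b\<in>?G. \<Sum>a\<in>A. real_of_int (?r b) *
      (if [int (P a) = int b] (mod int p) then real (P a) else 0))"
    unfolding sum_distrib_left by (subst sum.swap) (intro sum.cong refl, auto)
  also have "\<dots> = residue_conv p (\<lambda>b. real (prod_residue_sum p k (int b))) d"
    by (simp only: residue_conv_def prod_residue_sum_alt[OF p0] A_def P_def sum_distrib_left)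
  finally show ?thesis .
qed

section \<open>The error term and its induction\<close>

text \<open>The main term is the one of the theorem, written so that it also makes sense for
  \<open>k = 0\<close>, where the truncated exponent \<open>k - 1\<close> would give the wrong value.\<close>

definition prod_residue_error :: "nat \<Rightarrow> nat \<Rightarrow> int \<Rightarrow> real" where
  "prod_residue_error p k d = real (prod_residue_sum p k d)
     - (real p * (real p - 1) / 2) ^ k / (real p - 1)"

text \<open>The main term does not depend on \<open>d\<close>, and convolution multiplies it by
  \<open>p * (p - 1) / 2\<close>, exactly the passage from \<open>k\<close> to
  \<open>Suc k\<close>.\<close>

lemma prod_residue_error_Suc:
  assumes "prime p" "coprime d (int p)"
  shows "prod_residue_error p (Suc k) d = residue_conv p (\<lambda>b. prod_residue_error p k (int b)) d"
  unfolding prod_residue_error_def residue_conv_diff_const[OF assms] prod_residue_sum_Suc[OF assms]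
  by (simp add: mult_ac)

lemma coprime_int_residue:
  assumes "prime p" "b \<in> {1..<p}"
  shows "coprime (int b) (int p)"
  using not_dvd_residue_power[OF assms, of 1] assms(1)
  by (metis coprime_commute power_one_right prime_imp_coprime prime_nat_int_transfer)

lemma prod_residue_sum_0:
  assumes "prime p" "b \<in> {1..<p}"
  shows "prod_residue_sum p 0 (int b) = (if b = 1 then 1 else 0)"
proof -
  have "[1 = int b] (mod int p) \<longleftrightarrow> b = 1"
    using assms prime_gt_1_nat[OF assms(1)] by (auto simp: Cong.cong_def)
  thus ?thesis by (simp add: prod_residue_sum_def)
qed

text \<open>For \<open>k = 0\<close> the error is the indicator of \<open>1\<close> minus its mean
  \<open>1 / (p - 1)\<close>; convolution then preserves mean zero.\<close>

lemma sum_prod_residue_error: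
  assumes "prime p"
  shows "(\<Sum>b\<in>{1..<p}. prod_residue_error p k (int b)) = 0"
proof (induction k)
  case 0
  have p: "p > 1" using assms by (rule prime_gt_1_nat)
  have "(\<Sum>b\<in>{1..<p}. prod_residue_error p 0 (int b))
      = (\<Sum>b\<in>{1..<p}. (if b = 1 then 1 else 0) - 1 / (real p - 1))"
    using assms by (intro sum.cong refl) (auto simp: prod_residue_error_def prod_residue_sum_0)
  also have "\<dots> = 0" using p by (simp add: sum_subtractf of_nat_diff)
  finally show ?case .
next
  case (Suc k)
  have "(\<Sum>b\<in>{1..<p}. prod_residue_error p (Suc k) (int b))
      = (\<Sum>b\<in>{1..<p}. residue_conv p (\<lambda>b. prod_residue_error p k (int b)) (int b))"
    using assms by (intro sum.cong refl prod_residue_error_Suc coprime_int_residue)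
  also have "\<dots> = 0" by (simp only: sum_residue_conv[OF assms] Suc.IH mult_zero_right)
  finally show ?case .
qed

lemma L2_set_prod_residue_error_le:
  assumes "prime p"
  shows "L2_set (\<lambda>b. prod_residue_error p k (int b)) {1..<p}
       \<le> (6 * real p * sqrt (real p) * ln (real p)) ^ k"
proof (induction k)
  case 0
  have p: "p > 1" using assms by (rule prime_gt_1_nat)
  \<comment> \<open>Expanding the square of the centred indicator; the total is its variance-like
    value \<open>1 - 1 / (p - 1)\<close>, at most 1.\<close>
  have "(\<Sum>b\<in>{1..<p}. (prod_residue_error p 0 (int b))\<^sup>2)
      = (\<Sum>b\<in>{1..<p}. (if b = 1 then 1 - 2 / (real p - 1) else 0) + 1 / (real p - 1)\<^sup>2)"
    using assms
    by (intro sum.cong refl)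
       (auto simp: prod_residue_error_def prod_residue_sum_0 power2_diff power_divide)
  also have "\<dots> = 1 - 1 / (real p - 1)"
    using p by (simp add: sum.distrib of_nat_diff power2_eq_square)
  also have "\<dots> \<le> 1" using p by simp
  finally show ?case by (simp add: L2_set_def)
next
  case (Suc k)
  let ?M = "6 * real p * sqrt (real p) * ln (real p)"
  have "L2_set (\<lambda>b. prod_residue_error p (Suc k) (int b)) {1..<p}
      = L2_set (\<lambda>d. residue_conv p (\<lambda>b. prod_residue_error p k (int b)) (int d)) {1..<p}"
    using assms by (intro L2_set_cong refl prod_residue_error_Suc coprime_int_residue)
  also have "\<dots> \<le> ?M * L2_set (\<lambda>b. prod_residue_error p k (int b)) {1..<p}"
    by (intro L2_set_residue_conv_le assms sum_prod_residue_error)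
  also have "\<dots> \<le> ?M * ?M ^ k"
    using prime_ge_1_nat[OF assms] by (intro mult_left_mono Suc.IH) auto
  finally show ?case by simp
qed

text \<open>The error depends only on \<open>d\<close> modulo \<open>p\<close>, and a single value
  is at most the \<open>l2\<close> norm over all unit residues.\<close>

lemma abs_prod_residue_error_le:
  assumes "prime p" "coprime d (int p)"
  shows "\<bar>prod_residue_error p k d\<bar> \<le> (6 * real p * sqrt (real p) * ln (real p)) ^ k"
proof -
  define b where "b = nat (d mod int p)"
  have p0: "p > 0" using assms(1) by (rule prime_gt_0_nat)
  have ib: "int b = d mod int p" using p0 by (simp add: b_def)
  have "\<not> int p dvd d"
    using assms by (metis coprime_absorb_right not_prime_unit prime_nat_int_transfer)
  hence "int b \<noteq> 0" by (auto simp: ib)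
  moreover have "int b < int p" using p0 by (simp add: ib)
  ultimately have b: "b \<in> {1..<p}" by simp
  have "[d = int b] (mod int p)" by (simp add: ib)
  hence "\<bar>prod_residue_error p k d\<bar> = \<bar>prod_residue_error p k (int b)\<bar>"
    unfolding prod_residue_error_def by (simp only: prod_residue_sum_cong)
  also have "\<dots> \<le> L2_set (\<lambda>b. \<bar>prod_residue_error p k (int b)\<bar>) {1..<p}"
    using b by (intro member_le_L2_set[where f = "\<lambda>b. \<bar>prod_residue_error p k (int b)\<bar>"]) auto
  also have "\<dots> = L2_set (\<lambda>b. prod_residue_error p k (int b)) {1..<p}"
    by (simp add: L2_set_def)
  also have "\<dots> \<le> (6 * real p * sqrt (real p) * ln (real p)) ^ k"
    by (rule L2_set_prod_residue_error_le[OF assms(1)])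
  finally show ?thesis .
qed

theorem theorem3:
  fixes k :: nat
  assumes "k \<ge> 3"
  shows "\<exists>C::real. C > 0 \<and>
    (\<forall>(p::nat) (d::int). prime p \<longrightarrow> coprime d (int p) \<longrightarrow>
      \<bar>real (prod_residue_sum p k d) - real p ^ k * (real p - 1) ^ (k - 1) / 2 ^ k\<bar>
        \<le> C * (real p powr (3 * real k / 2) * ln (real p) ^ k))"
\<comment> \<open>Each of the \<open>k\<close> convolutions contributes one factor 6, from the sum
  of the Fourier coefficients.\<close>
proof (intro exI[of _ "6 ^ k"] conjI allI impI)
  fix p :: nat and d :: int
  assume p: "prime p" and d: "coprime d (int p)"
  have p1: "p > 1" using p by (rule prime_gt_1_nat)
  \<comment> \<open>A positive exponent lets the denominator \<open>p - 1\<close> cancel one factor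
    of the power.\<close>
  obtain m where m: "k = Suc m" using assms by (cases k) auto
  have "(real p * (real p - 1) / 2) ^ k / (real p - 1) = real p ^ k * (real p - 1) ^ (k - 1) / 2 ^ k"
    using p1 by (simp add: m power_mult_distrib power_divide)
  moreover have "(6 * real p * sqrt (real p) * ln (real p)) ^ k
      = 6 ^ k * (real p powr (3 * real k / 2) * ln (real p) ^ k)"
  proof -
    have "real p * sqrt (real p) = real p powr 1 * real p powr (1 / 2)"
      using p1 by (simp add: powr_half_sqrt)
    also have "\<dots> = real p powr (3 / 2)" by (simp only: powr_add[symmetric]) simp
    finally have "(real p * sqrt (real p)) ^ k = (real p powr (3 / 2)) powr real k"
      using p1 by (simp add: powr_realpow)
    also have "\<dots> = real p powr (3 * real k / 2)" by (simp add: powr_powr)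
    finally show ?thesis
      by (simp only: power_mult_distrib mult.assoc[symmetric]) (simp only: mult.assoc)
  qed
  ultimately show "\<bar>real (prod_residue_sum p k d) - real p ^ k * (real p - 1) ^ (k - 1) / 2 ^ k\<bar>
      \<le> 6 ^ k * (real p powr (3 * real k / 2) * ln (real p) ^ k)"
    using abs_prod_residue_error_le[OF p d, of k]
    by (simp only: prod_residue_error_def)
qed simp

end
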